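(* Let $X=(X,\varphi)$ be an $\mathbf r$-exterior flow, and let $\check\varphi_0\colon\mathbb R\times\check C_0(X)\to\check C_0(X)$ be the induced action, given by $\check\varphi_0(t,p_0(x))=p_0(\varphi(t,x))$ for $x\in X$ and $\check\varphi_0(t,\operatorname{in}_0(a))=\operatorname{in}_0(a)$ for $a\in\check\pi_0(X)$. Then $\check\varphi_0$ induces on $\check C_0(X)$ an $\mathbf r$-exterior flow structure; that is: (i) the map $\check\varphi_0\colon\mathbb R\times\check C_0(X)\to\check C_0(X)$ is continuous (for the topology of $\check C_0(X)$ described in the context); (ii) the map $\check\varphi_0\colon\mathbb R^{\mathbf r}\,\bar\times\,\check C_0(X)_{\mathbf d}\to\check C_0(X)$ is exterior; and (iii) for any $t\in\mathbb R$, the map $F_t\colon\check C_0(X)\,\bar\times\, I\to\check C_0(X)$, $F_t(x,s)=\check\varphi_0(ts,x)$, $s\in I$, $x\in\check C_0(X)$, is also exterior.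
   Context: Exterior spaces: an exterior space is a topological space $X$ together with a nonempty family $\varepsilon(X)$ of open subsets (an externology; its members are called exterior open subsets) closed under finite intersections and such that if $E\in\varepsilon(X)$, $U$ is open and $E\subset U$, then $U\in\varepsilon(X)$. A map is exterior if it is continuous and preimages of exterior open subsets are exterior open. For an exterior space $X$ and a topological space $Y$, $X\bar\times Y$ is $X\times Y$ with the product topology and the externology of those open $E$ such that for each $y\in Y$ there are an open neighbourhood $U_y$ of $y$ and $T^y\in\varepsilon(X)$ with $T^y\times U_y\subset E$. $I=[0,1]$. $\mathbb R^{\mathbf r}$ is $\mathbb R$ with externology $\mathbf r=\{U \text{ open}: (n,+\infty)\subset U\text{ for some } n\in\mathbb N\}$. For an exterior space $M$, $M_{\mathbf t}$ is the underlying topological space and $M_{\mathbf d}$ the underlying set with the discrete topology. An $\mathbf r$-exterior flow is an exterior space $M$ with a flow $\varphi\colon\mathbb R\times M_{\mathbf t}\to M_{\mathbf t}$ (a continuous action of the additive group $\mathbb R$) such that $\varphi\colon\mathbb R^{\mathbf r}\bar\times M_{\mathbf d}\to M$ is exterior and, for every $t\in\mathbb R$, $F_t\colon M\bar\times I\to M$, $F_t(x,s)=\varphi(ts,x)$, is exterior. Limit and end spaces: for a space $Y$, $\pi_0(Y)$ is the set of path-components with the quotient topology of $q_0\colon Y\to\pi_0(Y)$. $L(X)=\bigcap_{E\in\varepsilon(X)}E$ (subspace topology); $\check\pi_0(X)=\lim_{E\in\varepsilon(X)}\pi_0(E)$ (inverse limit topology), with projections $\eta_{0,E}\colon\check\pi_0(X)\to\pi_0(E)$;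 $e_0\colon L(X)\to\check\pi_0(X)$ sends $x$ to the family of path-components of $x$ in the sets $E$. Completion: $\check C_0(X)$ has underlying set the push-out $X\cup_{L(X)}\check\pi_0(X)$ of the inclusion $L(X)\to X$ and $e_0$, with canonical maps $p_0\colon X\to\check C_0(X)$, $\operatorname{in}_0\colon\check\pi_0(X)\to\check C_0(X)$. A subset $W$ is open iff (a) $p_0^{-1}(W)$ and $\operatorname{in}_0^{-1}(W)$ are open, and (b) for each $a\in\operatorname{in}_0^{-1}(W)$ there are $E\in\varepsilon(X)$ and an open $G\subset\pi_0(E)$ with $a\in\eta_{0,E}^{-1}(G)\subset\operatorname{in}_0^{-1}(W)$ and $q_0^{-1}(G)\subset p_0^{-1}(W)$. Its externology is $\{W_0(E): E\in\varepsilon(X)\}$ with $W_0(E)=p_0(E)\cup\operatorname{in}_0(\check\pi_0(X))$. *)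

theory Defs
  imports "HOL-Analysis.Analysis"
begin

section \<open>Exterior spaces\<close>

datatype 'a exterior = Exterior (etop: "'a topology") (externology: "'a set set")

definition exterior_space :: "'a exterior \<Rightarrow> bool" where
  "exterior_space X \<longleftrightarrow>
     externology X \<noteq> {} \<and>
     (\<forall>E\<in>externology X. openin (etop X) E) \<and>
     (\<forall>E\<in>externology X. \<forall>F\<in>externology X. E \<inter> F \<in> externology X) \<and>
     (\<forall>E\<in>externology X. \<forall>U. openin (etop X) U \<longrightarrow> E \<subseteq> U \<longrightarrow> U \<in> externology X)"

lemma
  assumes "exterior_space X"
  shows exterior_space_nonempty: "externology X \<noteq> {}"
    and exterior_space_open: "E \<in> externology X \<Longrightarrow> openin (etop X) E"
    and exterior_space_Int: "E \<in> externology X \<Longrightarrow> F \<in> externology X \<Longrightarrow> E \<inter> F \<in> externology X"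
  using assms unfolding exterior_space_def by blast+

definition exterior_map :: "'a exterior \<Rightarrow> 'b exterior \<Rightarrow> ('a \<Rightarrow> 'b) \<Rightarrow> bool" where
  "exterior_map X Y f \<longleftrightarrow>
     continuous_map (etop X) (etop Y) f \<and>
     (\<forall>E\<in>externology Y. {x \<in> topspace (etop X). f x \<in> E} \<in> externology X)"

definition bar_prod :: "'a exterior \<Rightarrow> 'b topology \<Rightarrow> ('a \<times> 'b) exterior" where
  "bar_prod X Y = Exterior (prod_topology (etop X) Y)
     {E. openin (prod_topology (etop X) Y) E \<and>
         (\<forall>y\<in>topspace Y. \<exists>U T. openin Y U \<and> y \<in> U \<and> T \<in> externology X \<and> T \<times> U \<subseteq> E)}"

definition real_r :: "real exterior" where
  "real_r = Exterior euclideanreal {U. open U \<and> (\<exists>n::nat. {real n<..} \<subseteq> U)}"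


section \<open>Exterior flows\<close>

definition flow :: "'a topology \<Rightarrow> (real \<times> 'a \<Rightarrow> 'a) \<Rightarrow> bool" where
  "flow T \<phi> \<longleftrightarrow>
     continuous_map (prod_topology euclideanreal T) T \<phi> \<and>
     (\<forall>x\<in>topspace T. \<phi> (0, x) = x) \<and>
     (\<forall>s t. \<forall>x\<in>topspace T. \<phi> (s, \<phi> (t, x)) = \<phi> (s + t, x))"

definition r_exterior_flow :: "'a exterior \<Rightarrow> (real \<times> 'a \<Rightarrow> 'a) \<Rightarrow> bool" where
  "r_exterior_flow M \<phi> \<longleftrightarrow>
     exterior_space M \<and>
     flow (etop M) \<phi> \<and>
     exterior_map (bar_prod real_r (discrete_topology (topspace (etop M)))) M \<phi> \<and>
     (\<forall>t. exterior_map (bar_prod M (top_of_set {0..1})) M (\<lambda>(x, s). \<phi> (t * s, x)))"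


section \<open>Path-components, limit space and end space\<close>

abbreviation q0 :: "'a topology \<Rightarrow> 'a \<Rightarrow> 'a set" where
  "q0 Y \<equiv> path_component_of_set Y"

definition pi0 :: "'a topology \<Rightarrow> 'a set topology" where
  "pi0 Y = topology (\<lambda>G. G \<subseteq> path_components_of Y \<and> openin Y {y \<in> topspace Y. q0 Y y \<in> G})"

lemma openin_pi0:
  "openin (pi0 Y) G \<longleftrightarrow> G \<subseteq> path_components_of Y \<and> openin Y {y \<in> topspace Y. q0 Y y \<in> G}"
proof -
  have "istopology (\<lambda>G. G \<subseteq> path_components_of Y \<and> openin Y {y \<in> topspace Y. q0 Y y \<in> G})"
    unfolding istopology_def
  proof (intro conjI allI impI)
    fix S T
    assume "S \<subseteq> path_components_of Y \<and> openin Y {y \<in> topspace Y. q0 Y y \<in> S}"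
      and "T \<subseteq> path_components_of Y \<and> openin Y {y \<in> topspace Y. q0 Y y \<in> T}"
    then show "openin Y {y \<in> topspace Y. q0 Y y \<in> S \<inter> T}"
      using openin_Int[of Y "{y \<in> topspace Y. q0 Y y \<in> S}" "{y \<in> topspace Y. q0 Y y \<in> T}"]
      by (simp add: Collect_conj_eq Int_ac)
  next
    fix K
    assume K: "\<forall>S\<in>K. S \<subseteq> path_components_of Y \<and> openin Y {y \<in> topspace Y. q0 Y y \<in> S}"
    have "{y \<in> topspace Y. q0 Y y \<in> \<Union>K} = (\<Union>S\<in>K. {y \<in> topspace Y. q0 Y y \<in> S})"
      by blast
    then show "openin Y {y \<in> topspace Y. q0 Y y \<in> \<Union>K}"
      using K by (auto simp only: intro!: openin_Union)
  qed blast+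
  then show ?thesis
    by (simp add: pi0_def)
qed

lemma topspace_pi0 [simp]: "topspace (pi0 Y) = path_components_of Y"
proof
  show "topspace (pi0 Y) \<subseteq> path_components_of Y"
    using openin_pi0 openin_topspace by blast
  have "{y \<in> topspace Y. q0 Y y \<in> path_components_of Y} = topspace Y"
    by (auto simp: path_components_of_def)
  then show "path_components_of Y \<subseteq> topspace (pi0 Y)"
    by (simp add: openin_pi0 openin_subset)
qed

lemma quotient_map_q0: "quotient_map Y (pi0 Y) (q0 Y)"
  by (auto simp: quotient_map_def openin_pi0 path_components_of_def)

text \<open>The map of path-components induced by an inclusion into \<open>Y\<close>, computed on a representative;
  see \<open>pi0_incl_q0\<close> for independence of the choice.\<close>

definition pi0_incl :: "'a topology \<Rightarrow> 'a set \<Rightarrow> 'a set" where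
  "pi0_incl Y C = q0 Y (SOME x. x \<in> C)"

lemma pi0_incl_q0:
  assumes "E \<subseteq> F" and "x \<in> topspace (subtopology T E)"
  shows "pi0_incl (subtopology T F) (q0 (subtopology T E) x) = q0 (subtopology T F) x"
proof -
  have "x \<in> q0 (subtopology T E) x"
    using assms(2) by (simp add: path_component_of_refl)
  then have "(SOME y. y \<in> q0 (subtopology T E) x) \<in> q0 (subtopology T E) x"
    by (rule someI)
  then have "path_component_of (subtopology T F) x (SOME y. y \<in> q0 (subtopology T E) x)"
    using assms(1) path_component_of_mono by fastforce
  then show ?thesis
    unfolding pi0_incl_def by (metis path_component_of_equiv)
qed

definition limit_space :: "'a exterior \<Rightarrow> 'a set" where
  "limit_space X = \<Inter>(externology X)"

definition end_space :: "'a exterior \<Rightarrow> ('a set \<Rightarrow> 'a set) topology" where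
  "end_space X =
     subtopology (product_topology (\<lambda>E. pi0 (subtopology (etop X) E)) (externology X))
       {a. \<forall>E\<in>externology X. \<forall>F\<in>externology X. E \<subseteq> F \<longrightarrow>
             pi0_incl (subtopology (etop X) F) (a E) = a F}"

definition eta0 :: "'a set \<Rightarrow> ('a set \<Rightarrow> 'a set) \<Rightarrow> 'a set" where
  "eta0 E a = a E"

definition e0 :: "'a exterior \<Rightarrow> 'a \<Rightarrow> ('a set \<Rightarrow> 'a set)" where
  "e0 X x = (\<lambda>E\<in>externology X. q0 (subtopology (etop X) E) x)"

lemma e0_in_end_space:
  assumes "exterior_space X" and "x \<in> limit_space X"
  shows "e0 X x \<in> topspace (end_space X)"
proof -
  have x: "x \<in> topspace (subtopology (etop X) E)" if "E \<in> externology X" for E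
    using that assms(2) openin_subset[OF exterior_space_open[OF assms(1) that]]
    by (auto simp: limit_space_def)
  have "q0 (subtopology (etop X) E) x \<in> path_components_of (subtopology (etop X) E)"
    if "E \<in> externology X" for E
    unfolding path_components_of_def using x[OF that] by (rule imageI)
  then have "e0 X x \<in> (\<Pi>\<^sub>E E\<in>externology X. path_components_of (subtopology (etop X) E))"
    unfolding e0_def by (intro restrict_PiE_iff[THEN iffD2] ballI)
  moreover have "pi0_incl (subtopology (etop X) F) (e0 X x E) = e0 X x F"
    if "E \<in> externology X" "F \<in> externology X" "E \<subseteq> F" for E F
    using that pi0_incl_q0[OF that(3) x[OF that(1)]] by (simp only: e0_def restrict_apply if_True)
  ultimately show ?thesis
    by (simp add: end_space_def)
qed


section \<open>The completion\<close>

text \<open>The push-out is the quotient of the disjoint union by the equivalence relation generated by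
  \<open>Inl x \<sim> Inr (e0 X x)\<close> for \<open>x\<close> in the limit space.\<close>

definition glue :: "'a exterior \<Rightarrow> ('a + ('a set \<Rightarrow> 'a set)) rel" where
  "glue X = (let R = {(Inl x, Inr (e0 X x)) | x. x \<in> limit_space X} in (R \<union> R\<inverse>)\<^sup>*)"

definition completion_set :: "'a exterior \<Rightarrow> ('a + ('a set \<Rightarrow> 'a set)) set set" where
  "completion_set X = (topspace (etop X) <+> topspace (end_space X)) // glue X"

definition p0 :: "'a exterior \<Rightarrow> 'a \<Rightarrow> ('a + ('a set \<Rightarrow> 'a set)) set" where
  "p0 X x = glue X `` {Inl x}"

definition in0 :: "'a exterior \<Rightarrow> ('a set \<Rightarrow> 'a set) \<Rightarrow> ('a + ('a set \<Rightarrow> 'a set)) set" where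
  "in0 X a = glue X `` {Inr a}"

definition p0_preimage :: "'a exterior \<Rightarrow> ('a + ('a set \<Rightarrow> 'a set)) set set \<Rightarrow> 'a set" where
  "p0_preimage X W = {x \<in> topspace (etop X). p0 X x \<in> W}"

definition in0_preimage ::
    "'a exterior \<Rightarrow> ('a + ('a set \<Rightarrow> 'a set)) set set \<Rightarrow> ('a set \<Rightarrow> 'a set) set" where
  "in0_preimage X W = {a \<in> topspace (end_space X). in0 X a \<in> W}"

definition completion_open :: "'a exterior \<Rightarrow> ('a + ('a set \<Rightarrow> 'a set)) set set \<Rightarrow> bool" where
  "completion_open X W \<longleftrightarrow>
     W \<subseteq> completion_set X \<and>
     openin (etop X) (p0_preimage X W) \<and>
     openin (end_space X) (in0_preimage X W) \<and>
     (\<forall>a\<in>in0_preimage X W. \<exists>E\<in>externology X. \<exists>G.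
        openin (pi0 (subtopology (etop X) E)) G \<and>
        eta0 E a \<in> G \<and>
        {b \<in> topspace (end_space X). eta0 E b \<in> G} \<subseteq> in0_preimage X W \<and>
        {x \<in> topspace (subtopology (etop X) E). q0 (subtopology (etop X) E) x \<in> G}
          \<subseteq> p0_preimage X W)"

definition W0 :: "'a exterior \<Rightarrow> 'a set \<Rightarrow> ('a + ('a set \<Rightarrow> 'a set)) set set" where
  "W0 X E = p0 X ` E \<union> in0 X ` topspace (end_space X)"

definition C0_completion :: "'a exterior \<Rightarrow> ('a + ('a set \<Rightarrow> 'a set)) set exterior" where
  "C0_completion X = Exterior (topology (completion_open X)) {W0 X E | E. E \<in> externology X}"

text \<open>Here \<open>\<phi>\<close> descends to the push-out; the equations \<open>completion_flow_p0\<close> and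
  \<open>completion_flow_in0\<close> below show that the description is well defined.\<close>

definition completion_flow ::
    "'a exterior \<Rightarrow> (real \<times> 'a \<Rightarrow> 'a) \<Rightarrow>
     real \<times> ('a + ('a set \<Rightarrow> 'a set)) set \<Rightarrow> ('a + ('a set \<Rightarrow> 'a set)) set" where
  "completion_flow X \<phi> = (\<lambda>(t, z). THE w.
     (\<exists>x\<in>topspace (etop X). z = p0 X x \<and> w = p0 X (\<phi> (t, x))) \<or>
     (\<exists>a\<in>topspace (end_space X). z = in0 X a \<and> w = in0 X a))"


subsection \<open>The definitions above make sense\<close>

lemma equiv_glue: "equiv UNIV (glue X)"
  unfolding glue_def Let_def
  by (intro equivI refl_rtrancl sym_rtrancl trans_rtrancl) (auto simp: sym_def)

text \<open>\<open>glue_rep\<close> replaces every point of the limit space by its end.\<close>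

definition glue_rep :: "'a exterior \<Rightarrow> 'a + ('a set \<Rightarrow> 'a set) \<Rightarrow> 'a + ('a set \<Rightarrow> 'a set)" where
  "glue_rep X u =
     (case u of Inl x \<Rightarrow> if x \<in> limit_space X then Inr (e0 X x) else Inl x | Inr a \<Rightarrow> Inr a)"

lemma glue_iff: "(u, v) \<in> glue X \<longleftrightarrow> glue_rep X u = glue_rep X v"
proof
  define R :: "('a + ('a set \<Rightarrow> 'a set)) rel"
    where "R = {(Inl x, Inr (e0 X x)) | x. x \<in> limit_space X}"
  have G: "glue X = (R \<union> R\<inverse>)\<^sup>*"
    by (simp only: glue_def R_def Let_def)
  show "glue_rep X u = glue_rep X v" if "(u, v) \<in> glue X"
    using that unfolding G by (induction rule: rtrancl_induct) (auto simp: R_def glue_rep_def)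
  have rep: "(w, glue_rep X w) \<in> glue X" for w
    unfolding G by (cases w) (auto simp: R_def glue_rep_def)
  show "(u, v) \<in> glue X" if eq: "glue_rep X u = glue_rep X v"
  proof -
    have "(glue_rep X u, v) \<in> glue X"
      unfolding eq using rep equiv_glue by (metis equiv_def symE)
    with rep[of u] show ?thesis
      unfolding G by (rule rtrancl_trans)
  qed
qed

lemma p0_eq_in0_iff: "p0 X x = in0 X a \<longleftrightarrow> x \<in> limit_space X \<and> a = e0 X x"
  by (auto simp: p0_def in0_def eq_equiv_class_iff[OF equiv_glue] glue_iff glue_rep_def)

lemma in0_eq_iff: "in0 X a = in0 X b \<longleftrightarrow> a = b"
  by (auto simp: in0_def eq_equiv_class_iff[OF equiv_glue] glue_iff glue_rep_def)

lemma p0_eq_iff: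
  "p0 X x = p0 X y \<longleftrightarrow> x = y \<or> x \<in> limit_space X \<and> y \<in> limit_space X \<and> e0 X x = e0 X y"
  by (auto simp: p0_def eq_equiv_class_iff[OF equiv_glue] glue_iff glue_rep_def)

lemma completion_set_eq:
  "completion_set X = p0 X ` topspace (etop X) \<union> in0 X ` topspace (end_space X)"
  by (auto simp: completion_set_def p0_def in0_def quotient_def Plus_def)

lemma istopology_completion_open:
  assumes X: "exterior_space X"
  shows "istopology (completion_open X)"
  unfolding istopology_def
proof (intro conjI allI impI)
  fix S T
  assume S: "completion_open X S" and T: "completion_open X T"
  let ?q = "\<lambda>E. q0 (subtopology (etop X) E)"
  have p: "p0_preimage X (S \<inter> T) = p0_preimage X S \<inter> p0_preimage X T"
    and i: "in0_preimage X (S \<inter> T) = in0_preimage X S \<inter> in0_preimage X T"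
    by (auto simp: p0_preimage_def in0_preimage_def)
  show "completion_open X (S \<inter> T)"
    unfolding completion_open_def p i
  proof (intro conjI ballI)
    show "S \<inter> T \<subseteq> completion_set X"
      using S by (auto simp: completion_open_def)
    show "openin (etop X) (p0_preimage X S \<inter> p0_preimage X T)"
      "openin (end_space X) (in0_preimage X S \<inter> in0_preimage X T)"
      using S T by (auto simp: completion_open_def)
    fix a
    assume a: "a \<in> in0_preimage X S \<inter> in0_preimage X T"
    obtain E G where E: "E \<in> externology X" and G: "openin (pi0 (subtopology (etop X) E)) G"
      "eta0 E a \<in> G" "{b \<in> topspace (end_space X). eta0 E b \<in> G} \<subseteq> in0_preimage X S"
      "{x \<in> topspace (subtopology (etop X) E). ?q E x \<in> G} \<subseteq> p0_preimage X S"
      using S a unfolding completion_open_def by blast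
    obtain F H where F: "F \<in> externology X" and H: "openin (pi0 (subtopology (etop X) F)) H"
      "eta0 F a \<in> H" "{b \<in> topspace (end_space X). eta0 F b \<in> H} \<subseteq> in0_preimage X T"
      "{x \<in> topspace (subtopology (etop X) F). ?q F x \<in> H} \<subseteq> p0_preimage X T"
      using T a unfolding completion_open_def by blast
    let ?D = "E \<inter> F"
    let ?Y = "subtopology (etop X) ?D"
    let ?K = "{C \<in> path_components_of ?Y. pi0_incl (subtopology (etop X) E) C \<in> G \<and>
                 pi0_incl (subtopology (etop X) F) C \<in> H}"
    have D: "?D \<in> externology X"
      using X E F by (rule exterior_space_Int)
    have op: "openin (etop X) E" "openin (etop X) F"
      using exterior_space_open[OF X] E F by blast+
    have sub: "E \<subseteq> topspace (etop X)" "F \<subseteq> topspace (etop X)"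
      using op openin_subset by blast+
    have qK: "{x \<in> topspace ?Y. ?q ?D x \<in> ?K} =
        {x \<in> topspace (subtopology (etop X) E). ?q E x \<in> G} \<inter>
        {x \<in> topspace (subtopology (etop X) F). ?q F x \<in> H}"
    proof -
      have "x \<in> ?D \<Longrightarrow> pi0_incl (subtopology (etop X) E) (?q ?D x) = ?q E x"
        and "x \<in> ?D \<Longrightarrow> pi0_incl (subtopology (etop X) F) (?q ?D x) = ?q F x" for x
        using sub by (intro pi0_incl_q0; force)+
      then show ?thesis
        using sub by (auto simp: path_components_of_def)
    qed
    have "openin (etop X) {x \<in> topspace (subtopology (etop X) E). ?q E x \<in> G}"
      "openin (etop X) {x \<in> topspace (subtopology (etop X) F). ?q F x \<in> H}"
      using G(1) H(1) op openin_trans_full by (auto simp only: openin_pi0)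
    then have "openin (etop X) {x \<in> topspace ?Y. ?q ?D x \<in> ?K}"
      unfolding qK by (rule openin_Int)
    moreover have "{x \<in> topspace ?Y. ?q ?D x \<in> ?K} \<subseteq> ?D"
      by auto
    ultimately have "openin ?Y {x \<in> topspace ?Y. ?q ?D x \<in> ?K}"
      using openin_open_subtopology[OF openin_Int[OF op]] by blast
    then have K: "openin (pi0 ?Y) ?K"
      unfolding openin_pi0 by blast
    have etaK: "eta0 ?D b \<in> ?K \<longleftrightarrow> eta0 E b \<in> G \<and> eta0 F b \<in> H"
      if "b \<in> topspace (end_space X)" for b
      using that D E F by (auto simp: end_space_def eta0_def PiE_iff)
    have "a \<in> topspace (end_space X)"
      using a by (simp add: in0_preimage_def)
    then have "eta0 ?D a \<in> ?K"
      using etaK G(2) H(2) by blast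
    moreover have "{b \<in> topspace (end_space X). eta0 ?D b \<in> ?K}
        \<subseteq> in0_preimage X S \<inter> in0_preimage X T"
      using etaK G(3) H(3) by blast
    moreover have "{x \<in> topspace ?Y. ?q ?D x \<in> ?K} \<subseteq> p0_preimage X S \<inter> p0_preimage X T"
      unfolding qK using G(4) H(4) by blast
    ultimately show "\<exists>E\<in>externology X. \<exists>G. openin (pi0 (subtopology (etop X) E)) G \<and>
        eta0 E a \<in> G \<and>
        {b \<in> topspace (end_space X). eta0 E b \<in> G} \<subseteq> in0_preimage X S \<inter> in0_preimage X T \<and>
        {x \<in> topspace (subtopology (etop X) E). ?q E x \<in> G}
          \<subseteq> p0_preimage X S \<inter> p0_preimage X T"
      using D K by blast
  qed
next
  fix K
  assume K: "\<forall>S\<in>K. completion_open X S"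
  have p: "p0_preimage X (\<Union>K) = (\<Union>S\<in>K. p0_preimage X S)"
    and i: "in0_preimage X (\<Union>K) = (\<Union>S\<in>K. in0_preimage X S)"
    by (auto simp: p0_preimage_def in0_preimage_def)
  show "completion_open X (\<Union>K)"
    unfolding completion_open_def
  proof (intro conjI ballI)
    show "\<Union>K \<subseteq> completion_set X"
      using K by (auto simp: completion_open_def)
    show "openin (etop X) (p0_preimage X (\<Union>K))" "openin (end_space X) (in0_preimage X (\<Union>K))"
      unfolding p i using K by (auto simp: completion_open_def)
    fix a
    assume "a \<in> in0_preimage X (\<Union>K)"
    then obtain S where S: "S \<in> K" "a \<in> in0_preimage X S"
      using i by blast
    then obtain E G where "E \<in> externology X" "openin (pi0 (subtopology (etop X) E)) G"
      "eta0 E a \<in> G" "{b \<in> topspace (end_space X). eta0 E b \<in> G} \<subseteq> in0_preimage X S"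
      "{x \<in> topspace (subtopology (etop X) E). q0 (subtopology (etop X) E) x \<in> G}
         \<subseteq> p0_preimage X S"
      using K unfolding completion_open_def by blast
    moreover have "in0_preimage X S \<subseteq> in0_preimage X (\<Union>K)" "p0_preimage X S \<subseteq> p0_preimage X (\<Union>K)"
      using S p i by blast+
    ultimately show "\<exists>E\<in>externology X. \<exists>G. openin (pi0 (subtopology (etop X) E)) G \<and>
        eta0 E a \<in> G \<and>
        {b \<in> topspace (end_space X). eta0 E b \<in> G} \<subseteq> in0_preimage X (\<Union>K) \<and>
        {x \<in> topspace (subtopology (etop X) E). q0 (subtopology (etop X) E) x \<in> G}
          \<subseteq> p0_preimage X (\<Union>K)"
      by (meson order_trans)
  qed
qed

lemma openin_completion:
  "exterior_space X \<Longrightarrow> openin (etop (C0_completion X)) W \<longleftrightarrow> completion_open X W"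
  by (simp add: C0_completion_def istopology_completion_open)

lemma topspace_completion:
  assumes X: "exterior_space X"
  shows "topspace (etop (C0_completion X)) = completion_set X"
proof
  show "topspace (etop (C0_completion X)) \<subseteq> completion_set X"
    using openin_topspace[of "etop (C0_completion X)"]
    unfolding openin_completion[OF X] completion_open_def by blast
  have p: "p0_preimage X (completion_set X) = topspace (etop X)"
    and i: "in0_preimage X (completion_set X) = topspace (end_space X)"
    by (auto simp: p0_preimage_def in0_preimage_def completion_set_eq)
  obtain E where E: "E \<in> externology X"
    using exterior_space_nonempty[OF X] by blast
  have "completion_open X (completion_set X)"
    unfolding completion_open_def p i
  proof (intro conjI ballI bexI exI)
    fix a
    assume "a \<in> topspace (end_space X)"
    then show "eta0 E a \<in> path_components_of (subtopology (etop X) E)"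
      using E by (auto simp: end_space_def eta0_def PiE_iff)
    show "openin (pi0 (subtopology (etop X) E)) (path_components_of (subtopology (etop X) E))"
      by (metis openin_topspace topspace_pi0)
  qed (use E in auto)
  then show "completion_set X \<subseteq> topspace (etop (C0_completion X))"
    by (simp add: openin_completion[OF X] openin_subset)
qed

lemma
  assumes X: "r_exterior_flow X \<phi>" and x: "x \<in> limit_space X"
  shows limit_space_flow: "\<phi> (t, x) \<in> limit_space X"
    and e0_flow: "e0 X (\<phi> (t, x)) = e0 X x"
proof -
  let ?f = "\<lambda>s. \<phi> (t * s, x)"
  have ext: "exterior_space X" and fl: "flow (etop X) \<phi>"
    and F: "exterior_map (bar_prod X (top_of_set {0..1})) X (\<lambda>(x, s). \<phi> (t * s, x))"
    using X by (auto simp: r_exterior_flow_def)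
  have xX: "x \<in> topspace (etop X)"
    using exterior_space_nonempty[OF ext] openin_subset[OF exterior_space_open[OF ext]] x
    unfolding limit_space_def by blast
  have "continuous_map (top_of_set {0..1}) (etop X) ((\<lambda>(x, s). \<phi> (t * s, x)) \<circ> (\<lambda>s. (x, s)))"
    using F xX unfolding exterior_map_def bar_prod_def
    by (intro continuous_map_compose[of _ "prod_topology (etop X) (top_of_set {0..1})"])
       (auto simp: continuous_map_pairwise o_def)
  then have path: "pathin (etop X) ?f"
    by (simp add: pathin_def o_def)
  have inE: "?f s \<in> E" if E: "E \<in> externology X" and s: "s \<in> {0..1}" for E s
  proof -
    have "{z \<in> topspace (etop (bar_prod X (top_of_set {0..1}))).
            (\<lambda>(x, s). \<phi> (t * s, x)) z \<in> E} \<in> externology (bar_prod X (top_of_set {0..1::real}))"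
      using F E by (simp add: exterior_map_def)
    then have "\<forall>y\<in>topspace (top_of_set {0..1}). \<exists>U T. openin (top_of_set {0..1}) U \<and> y \<in> U \<and>
        T \<in> externology X \<and>
        T \<times> U \<subseteq> {z \<in> topspace (etop (bar_prod X (top_of_set {0..1}))).
                   (\<lambda>(x, s). \<phi> (t * s, x)) z \<in> E}"
      unfolding bar_prod_def exterior.sel mem_Collect_eq by (rule conjunct2)
    moreover have "s \<in> topspace (top_of_set {0..1})"
      using s by simp
    ultimately obtain U T where U: "s \<in> U" and T: "T \<in> externology X"
      and sub: "T \<times> U \<subseteq> {z \<in> topspace (etop (bar_prod X (top_of_set {0..1}))).
                      (\<lambda>(x, s). \<phi> (t * s, x)) z \<in> E}"
      by meson
    have "(x, s) \<in> T \<times> U"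
      using U T x by (simp add: limit_space_def)
    from subsetD[OF sub this] show ?thesis
      by simp
  qed
  have f0: "?f 0 = x"
    using fl xX by (simp add: flow_def)
  show "\<phi> (t, x) \<in> limit_space X"
    using inE[of _ 1] by (auto simp: limit_space_def)
  have "q0 (subtopology (etop X) E) (\<phi> (t, x)) = q0 (subtopology (etop X) E) x"
    if E: "E \<in> externology X" for E
  proof -
    have "pathin (subtopology (etop X) E) ?f"
      using path inE[OF E] by (simp add: pathin_subtopology)
    then have "path_component_of (subtopology (etop X) E) x (\<phi> (t, x))"
      unfolding path_component_of_def using f0 by (intro exI[of _ ?f]) auto
    then show ?thesis
      by (metis path_component_of_equiv)
  qed
  then show "e0 X (\<phi> (t, x)) = e0 X x"
    by (auto simp: e0_def fun_eq_iff)
qed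

lemma completion_flow_p0:
  assumes X: "r_exterior_flow X \<phi>" and x: "x \<in> topspace (etop X)"
  shows "completion_flow X \<phi> (t, p0 X x) = p0 X (\<phi> (t, x))"
proof -
  have P: "p0 X y = p0 X x \<Longrightarrow> p0 X (\<phi> (t, y)) = p0 X (\<phi> (t, x))" for y
    unfolding p0_eq_iff using limit_space_flow[OF X] e0_flow[OF X] by auto
  have I: "p0 X x = in0 X a \<Longrightarrow> in0 X a = p0 X (\<phi> (t, x))" for a
    using limit_space_flow[OF X] e0_flow[OF X] by (metis p0_eq_in0_iff)
  show ?thesis
    unfolding completion_flow_def split_conv
    by (rule the_equality) (use x in blast, metis P I)
qed

lemma completion_flow_in0:
  assumes X: "r_exterior_flow X \<phi>" and a: "a \<in> topspace (end_space X)"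
  shows "completion_flow X \<phi> (t, in0 X a) = in0 X a"
proof -
  have I: "in0 X a = p0 X x \<Longrightarrow> p0 X (\<phi> (t, x)) = in0 X a" for x
    using limit_space_flow[OF X] e0_flow[OF X] by (metis p0_eq_in0_iff)
  show ?thesis
    unfolding completion_flow_def split_conv
    by (rule the_equality) (use a in blast, metis I)
qed

end

theory Submission
  imports Defs
begin

text \<open>
  The difficulty is the continuity of the induced action: the image in the completion of an open set
  of \<open>X\<close> need not be open, since an open set of the completion is a neighbourhood of every end that
  it contains. So instead of building neighbourhoods point by point, one starts from an open set \<open>W\<close>
  of the completion and a compact interval \<open>J\<close> of times, and shows that the set \<open>W\<^sub>J\<close> of all points whose orbit
  stays in \<open>W\<close> during \<open>J\<close> is again open (\<open>completion_open_staying_set\<close>). Since every orbit is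
  continuous, each \<open>(t, z)\<close> that is sent into \<open>W\<close> lies in \<open>J \<times> W\<^sub>J\<close> for some small interval \<open>J\<close>
  around \<open>t\<close>, and \<open>J \<times> W\<^sub>J\<close> is sent into \<open>W\<close>; continuity follows.

  That \<open>W\<^sub>J\<close> is open in \<open>X\<close> is the tube lemma. Its condition at an end \<open>a\<close> is where the hypothesis
  on the maps \<open>F\<^sub>t\<close> enters: by compactness of \<open>[0,1]\<close>, each exterior open \<open>E\<close> contains an exterior
  open \<open>D\<close> whose points do not leave \<open>E\<close> during \<open>J\<close> (\<open>exterior_open_confined\<close>). The orbit of a
  point of \<open>D\<close> is then a path in \<open>E\<close>, so its path-component in \<open>E\<close> does not change, and a basic
  neighbourhood of \<open>a\<close> given by a set \<open>G\<close> of path-components of \<open>E\<close> can be pulled back along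
  \<open>\<pi>\<^sub>0(D) \<rightarrow> \<pi>\<^sub>0(E)\<close> to one contained in \<open>W\<^sub>J\<close>.

  The two exteriority conditions are checked on the sets \<open>W\<^sub>0(E)\<close>. The preimage of \<open>W\<^sub>0(E)\<close> in \<open>X\<close> is
  \<open>E\<close> itself because \<open>E\<close> contains the limit space, and all ends are fixed, so both conditions reduce
  to those for \<open>X\<close>.
\<close>


section \<open>Compactness in the exterior direction\<close>

lemma exterior_space_topspace:
  assumes "exterior_space X"
  shows "topspace (etop X) \<in> externology X"
  using assms unfolding exterior_space_def by (meson ex_in_conv openin_subset openin_topspace)

lemma exterior_space_Inter:
  assumes X: "exterior_space X" and "finite I" and "\<And>i. i \<in> I \<Longrightarrow> T i \<in> externology X"
  shows "topspace (etop X) \<inter> (\<Inter>i\<in>I. T i) \<in> externology X"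
  using assms(2,3)
proof (induction I rule: finite_induct)
  case empty
  then show ?case using exterior_space_topspace[OF X] by simp
next
  case (insert i I)
  then have "T i \<inter> (topspace (etop X) \<inter> (\<Inter>i\<in>I. T i)) \<in> externology X"
    using exterior_space_Int[OF X] by blast
  then show ?case by (simp add: Int_left_commute)
qed

lemma externology_bar_prodD:
  assumes "A \<in> externology (bar_prod X Y)" and "y \<in> topspace Y"
  shows "\<exists>U T. openin Y U \<and> y \<in> U \<and> T \<in> externology X \<and> T \<times> U \<subseteq> A"
  using assms by (simp add: bar_prod_def)

text \<open>Over a compact factor finitely many of the boxes \<open>T \<times> U\<close> cover, and the finite intersection of
  their exterior sides is still exterior.\<close>

lemma bar_prod_compact_tube:
  assumes X: "exterior_space X" and K: "compact_space K"
    and A: "A \<in> externology (bar_prod X K)"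
  obtains T where "T \<in> externology X" "T \<times> topspace K \<subseteq> A"
proof -
  obtain U T where UT: "\<And>y. y \<in> topspace K \<Longrightarrow>
      openin K (U y) \<and> y \<in> U y \<and> T y \<in> externology X \<and> T y \<times> U y \<subseteq> A"
    using externology_bar_prodD[OF A] by metis
  have "\<exists>F. finite F \<and> F \<subseteq> U ` topspace K \<and> topspace K \<subseteq> \<Union>F"
  proof (rule K[unfolded compact_space_alt, rule_format])
    show "(\<forall>V\<in>U ` topspace K. openin K V) \<and> topspace K \<subseteq> \<Union>(U ` topspace K)"
      using UT by blast
  qed
  then obtain F where "finite F" "F \<subseteq> U ` topspace K" "topspace K \<subseteq> \<Union>F"
    by blast
  then obtain I where I: "finite I" "I \<subseteq> topspace K" "topspace K \<subseteq> (\<Union>y\<in>I. U y)"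
    by (metis finite_subset_image)
  have "topspace (etop X) \<inter> (\<Inter>y\<in>I. T y) \<in> externology X"
    using exterior_space_Inter[OF X I(1)] UT I(2) by blast
  moreover have "(topspace (etop X) \<inter> (\<Inter>y\<in>I. T y)) \<times> topspace K \<subseteq> A"
  proof clarify
    fix x y
    assume x: "x \<in> (\<Inter>y\<in>I. T y)" and "y \<in> topspace K"
    then obtain i where "i \<in> I" "y \<in> U i"
      using I(3) by blast
    then have "(x, y) \<in> T i \<times> U i"
      using x by blast
    then show "(x, y) \<in> A"
      using UT I(2) \<open>i \<in> I\<close> by blast
  qed
  ultimately show ?thesis
    using that by blast
qed

text \<open>The open neighbourhoods of a point form an externology, for which the previous lemma is the
  usual tube lemma.\<close>

lemma compact_tube:
  assumes K: "compact_space K" and A: "openin (prod_topology Y K) A"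
    and x: "x \<in> topspace Y" and xA: "{x} \<times> topspace K \<subseteq> A"
  obtains V where "openin Y V" "x \<in> V" "V \<times> topspace K \<subseteq> A"
proof -
  let ?N = "Exterior Y {V. openin Y V \<and> x \<in> V}"
  have N: "exterior_space ?N"
    using x unfolding exterior_space_def by auto
  have "A \<in> externology (bar_prod ?N K)"
    unfolding bar_prod_def exterior.sel mem_Collect_eq
  proof (intro conjI A ballI)
    fix y
    assume "y \<in> topspace K"
    then have "(x, y) \<in> A"
      using xA by blast
    then show "\<exists>U T. openin K U \<and> y \<in> U \<and> (openin Y T \<and> x \<in> T) \<and> T \<times> U \<subseteq> A"
      using A unfolding openin_prod_topology_alt by meson
  qed
  then obtain T where "T \<in> externology ?N" "T \<times> topspace K \<subseteq> A"
    by (rule bar_prod_compact_tube[OF N K])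
  then show ?thesis
    by (intro that[of T]) simp_all
qed

lemma openin_forall_compact:
  assumes f: "continuous_map (prod_topology euclideanreal Y) Y f" and V: "openin Y V"
  shows "openin Y {x \<in> topspace Y. \<forall>s\<in>{c..d}. f (s, x) \<in> V}"
proof (subst openin_subopen, clarify)
  let ?K = "top_of_set {c..d}"
  let ?A = "{p \<in> topspace (prod_topology Y ?K). (case p of (x, s) \<Rightarrow> f (s, x)) \<in> V}"
  fix x
  assume x: "x \<in> topspace Y" "\<forall>s\<in>{c..d}. f (s, x) \<in> V"
  have snd: "continuous_map (prod_topology Y ?K) euclideanreal snd"
    using continuous_map_snd continuous_map_into_fulltopology by blast
  have "continuous_map (prod_topology Y ?K) Y (f \<circ> (\<lambda>p. (snd p, fst p)))"
    by (rule continuous_map_compose[OF continuous_map_pairedI[OF snd continuous_map_fst] f])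
  then have "continuous_map (prod_topology Y ?K) Y (\<lambda>(x, s). f (s, x))"
    by (simp add: o_def case_prod_unfold)
  then have A: "openin (prod_topology Y ?K) ?A"
    using V by (rule openin_continuous_map_preimage)
  have K: "compact_space ?K"
    by (simp add: compact_space_subtopology)
  have "{x} \<times> topspace ?K \<subseteq> ?A"
    using x by auto
  then obtain T where T: "openin Y T" "x \<in> T" "T \<times> topspace ?K \<subseteq> ?A"
    using compact_tube[OF K A x(1)] by blast
  moreover have "T \<subseteq> {x \<in> topspace Y. \<forall>s\<in>{c..d}. f (s, x) \<in> V}"
    using T(3) openin_subset[OF T(1)] by auto
  ultimately show "\<exists>T. openin Y T \<and> x \<in> T \<and> T \<subseteq> {x \<in> topspace Y. \<forall>s\<in>{c..d}. f (s, x) \<in> V}"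
    by blast
qed


section \<open>Orbits starting in exterior open sets\<close>

lemma r_exterior_flow_exterior_space: "r_exterior_flow X \<phi> \<Longrightarrow> exterior_space X"
  and r_exterior_flow_flow: "r_exterior_flow X \<phi> \<Longrightarrow> flow (etop X) \<phi>"
  by (simp_all add: r_exterior_flow_def)

lemma flow_in_topspace: "flow T \<phi> \<Longrightarrow> x \<in> topspace T \<Longrightarrow> \<phi> (t, x) \<in> topspace T"
  by (force simp: flow_def continuous_map_def)

lemma flow_orbit_continuous:
  assumes "flow T \<phi>" and "x \<in> topspace T"
  shows "continuous_map euclideanreal T (\<lambda>t. \<phi> (t, x))"
proof -
  have "continuous_map euclideanreal T (\<phi> \<circ> (\<lambda>t. (t, x)))"
    using assms
    by (intro continuous_map_compose[of _ "prod_topology euclideanreal T"])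
       (auto simp: flow_def intro: continuous_map_pairedI)
  then show ?thesis
    by (simp add: o_def)
qed

lemma exterior_open_subset_topspace:
  "exterior_space X \<Longrightarrow> E \<in> externology X \<Longrightarrow> E \<subseteq> topspace (etop X)"
  by (rule openin_subset[OF exterior_space_open])

lemma exterior_open_confined_one_sided:
  assumes X: "r_exterior_flow X \<phi>" and E: "E \<in> externology X"
  shows "\<exists>D\<in>externology X. \<forall>x\<in>D. \<forall>s\<in>{0..1}. \<phi> (t * s, x) \<in> E"
proof -
  let ?K = "top_of_set {0..1::real}"
  let ?A = "{p \<in> topspace (etop (bar_prod X ?K)). (\<lambda>(x, s). \<phi> (t * s, x)) p \<in> E}"
  have "exterior_map (bar_prod X ?K) X (\<lambda>(x, s). \<phi> (t * s, x))"
    using X by (simp add: r_exterior_flow_def)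
  then have A: "?A \<in> externology (bar_prod X ?K)"
    using E by (simp add: exterior_map_def)
  have K: "compact_space ?K"
    by (simp add: compact_space_subtopology)
  obtain D where D: "D \<in> externology X" "D \<times> topspace ?K \<subseteq> ?A"
    by (rule bar_prod_compact_tube[OF r_exterior_flow_exterior_space[OF X] K A])
  have "\<phi> (t * s, x) \<in> E" if "x \<in> D" "s \<in> {0..1}" for x s
  proof -
    have "(x, s) \<in> D \<times> topspace ?K"
      using that by simp
    then have "(x, s) \<in> ?A"
      using D(2) by (rule rev_subsetD)
    then show ?thesis
      by simp
  qed
  then show ?thesis
    using D(1) by blast
qed

text \<open>The maps \<open>F\<^sub>t\<close> and \<open>F\<^sub>-\<^sub>t\<close> control the orbits forward and backward in time.\<close>

lemma exterior_open_confined: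
  assumes X: "r_exterior_flow X \<phi>" and E: "E \<in> externology X"
  shows "\<exists>D\<in>externology X. D \<subseteq> E \<and> (\<forall>x\<in>D. \<forall>s. \<bar>s\<bar> \<le> t \<longrightarrow> \<phi> (s, x) \<in> E)"
proof -
  obtain A where A: "A \<in> externology X" "\<And>x s. x \<in> A \<Longrightarrow> s \<in> {0..1} \<Longrightarrow> \<phi> (t * s, x) \<in> E"
    using exterior_open_confined_one_sided[OF X E, of t] by blast
  obtain B where B: "B \<in> externology X" "\<And>x s. x \<in> B \<Longrightarrow> s \<in> {0..1} \<Longrightarrow> \<phi> (- t * s, x) \<in> E"
    using exterior_open_confined_one_sided[OF X E, of "- t"] by blast
  have "\<phi> (s, x) \<in> E" if x: "x \<in> E \<inter> (A \<inter> B)" and s: "\<bar>s\<bar> \<le> t" for x s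
  proof (cases "t = 0")
    case True
    then show ?thesis
      using A(2)[of x 0] x s by simp
  next
    case False
    then have "t > 0"
      using s by linarith
    then consider "s / t \<in> {0..1}" | "- s / t \<in> {0..1}"
      using s by (fastforce simp: field_simps)
    then show ?thesis
    proof cases
      case 1
      from A(2)[OF _ this] show ?thesis
        using x False by simp
    next
      case 2
      from B(2)[OF _ this] show ?thesis
        using x False by simp
    qed
  qed
  moreover have "E \<inter> (A \<inter> B) \<in> externology X"
    using exterior_space_Int[OF r_exterior_flow_exterior_space[OF X]] A(1) B(1) E by blast
  ultimately show ?thesis
    by (intro bexI[of _ "E \<inter> (A \<inter> B)"]) auto
qed

text \<open>The orbit from time \<open>0\<close> to time \<open>t\<close> is a path in \<open>E\<close>. This is why the action can be trivial on
  ends.\<close>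

lemma q0_flow_eq:
  assumes fl: "flow T \<phi>" and x: "x \<in> topspace T" and E: "\<And>s. \<bar>s\<bar> \<le> \<bar>t\<bar> \<Longrightarrow> \<phi> (s, x) \<in> E"
  shows "q0 (subtopology T E) (\<phi> (t, x)) = q0 (subtopology T E) x"
proof -
  have "continuous_map (top_of_set {0..1}) euclideanreal (\<lambda>s. t * s)"
    by (simp add: continuous_on_mult_left)
  then have "continuous_map (top_of_set {0..1}) T ((\<lambda>s. \<phi> (s, x)) \<circ> (\<lambda>s. t * s))"
    using flow_orbit_continuous[OF fl x] by (rule continuous_map_compose)
  then have "pathin T (\<lambda>s. \<phi> (t * s, x))"
    by (simp add: pathin_def o_def)
  moreover have "\<phi> (t * s, x) \<in> E" if "s \<in> {0..1}" for s
    using that by (intro E) (simp add: abs_mult mult_left_le)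
  ultimately have "pathin (subtopology T E) (\<lambda>s. \<phi> (t * s, x))"
    by (simp add: pathin_subtopology)
  then have "path_component_of (subtopology T E) x (\<phi> (t, x))"
    unfolding path_component_of_def using fl x
    by (intro exI[of _ "\<lambda>s. \<phi> (t * s, x)"]) (auto simp: flow_def)
  then show ?thesis
    by (metis path_component_of_equiv)
qed


section \<open>Open sets and exterior open sets of the completion\<close>

lemma limit_space_subset: "E \<in> externology X \<Longrightarrow> limit_space X \<subseteq> E"
  by (auto simp: limit_space_def)

text \<open>Points are identified only inside the limit space, which every exterior open set contains, so
  \<open>E\<close> is saturated.\<close>

lemma p0_in_W0_iff:
  assumes "E \<in> externology X" and "exterior_space X"
  shows "p0 X x \<in> W0 X E \<longleftrightarrow> x \<in> E"
  using limit_space_subset[OF assms(1)]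
  by (auto simp: W0_def p0_eq_iff p0_eq_in0_iff)

lemma in0_in_W0: "a \<in> topspace (end_space X) \<Longrightarrow> in0 X a \<in> W0 X E"
  by (simp add: W0_def)

lemma p0_preimage_W0:
  assumes "exterior_space X" and "E \<in> externology X"
  shows "p0_preimage X (W0 X E) = E"
  using exterior_open_subset_topspace[OF assms] p0_in_W0_iff[OF assms(2,1)]
  by (auto simp: p0_preimage_def)

lemma W0_subset_completion_set:
  assumes "exterior_space X" and "E \<in> externology X"
  shows "W0 X E \<subseteq> completion_set X"
  using exterior_open_subset_topspace[OF assms] by (auto simp: W0_def completion_set_eq)

lemma eta0_in_pi0:
  assumes "a \<in> topspace (end_space X)" and "E \<in> externology X"
  shows "eta0 E a \<in> path_components_of (subtopology (etop X) E)"
  using assms by (auto simp: end_space_def eta0_def PiE_iff)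

lemma pi0_incl_eta0:
  assumes "a \<in> topspace (end_space X)" and "D \<in> externology X" "E \<in> externology X" "D \<subseteq> E"
  shows "pi0_incl (subtopology (etop X) E) (eta0 D a) = eta0 E a"
  using assms by (auto simp: end_space_def eta0_def)

lemma completion_open_W0:
  assumes X: "exterior_space X" and E: "E \<in> externology X"
  shows "completion_open X (W0 X E)"
proof -
  have i: "in0_preimage X (W0 X E) = topspace (end_space X)"
    by (auto simp: in0_preimage_def in0_in_W0)
  show ?thesis
    unfolding completion_open_def p0_preimage_W0[OF X E] i
  proof (intro conjI ballI bexI[OF _ E] exI)
    show "openin (pi0 (subtopology (etop X) E)) (path_components_of (subtopology (etop X) E))"
      by (metis openin_topspace topspace_pi0)
  qed (use W0_subset_completion_set[OF X E] exterior_space_open[OF X E] eta0_in_pi0[OF _ E] in auto)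
qed

text \<open>An open set that contains some \<open>W\<^sub>0(E)\<close> contains all ends, hence is \<open>W\<^sub>0\<close> of its own preimage in
  \<open>X\<close>, which contains \<open>E\<close>.\<close>

lemma exterior_space_completion:
  assumes X: "exterior_space X"
  shows "exterior_space (C0_completion X)"
proof -
  have Int: "W0 X E \<inter> W0 X F = W0 X (E \<inter> F)"
    if E: "E \<in> externology X" and F: "F \<in> externology X" for E F
  proof
    show "W0 X E \<inter> W0 X F \<subseteq> W0 X (E \<inter> F)"
    proof
      fix z
      assume z: "z \<in> W0 X E \<inter> W0 X F"
      then consider x where "x \<in> E" "z = p0 X x" | a where "a \<in> topspace (end_space X)" "z = in0 X a"
        unfolding W0_def by blast
      then show "z \<in> W0 X (E \<inter> F)"
      proof cases
        case 1
        then have "x \<in> F"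
          using z p0_in_W0_iff[OF F X] by blast
        then show ?thesis
          using 1 by (auto simp: W0_def)
      qed (simp add: in0_in_W0)
    qed
  qed (auto simp: W0_def)
  have up: "W = W0 X (p0_preimage X W) \<and> p0_preimage X W \<in> externology X"
    if E: "E \<in> externology X" and W: "completion_open X W" and sub: "W0 X E \<subseteq> W" for E W
  proof
    have "E \<subseteq> p0_preimage X W"
      using p0_preimage_W0[OF X E] sub by (auto simp: p0_preimage_def)
    then show "p0_preimage X W \<in> externology X"
      using X E W unfolding exterior_space_def completion_open_def by blast
    show "W = W0 X (p0_preimage X W)"
      using W sub unfolding completion_open_def completion_set_eq
      by (auto simp: W0_def p0_preimage_def)
  qed
  have ext: "externology (C0_completion X) = {W0 X E | E. E \<in> externology X}"
    by (simp add: C0_completion_def)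
  show ?thesis
    unfolding exterior_space_def openin_completion[OF X] ext
  proof (intro conjI ballI allI impI)
    show "{W0 X E |E. E \<in> externology X} \<noteq> {}"
      using exterior_space_nonempty[OF X] by blast
  next
    fix W
    assume "W \<in> {W0 X E |E. E \<in> externology X}"
    then show "completion_open X W"
      using completion_open_W0[OF X] by blast
  next
    fix V W
    assume "V \<in> {W0 X E |E. E \<in> externology X}" "W \<in> {W0 X E |E. E \<in> externology X}"
    then show "V \<inter> W \<in> {W0 X E |E. E \<in> externology X}"
      using Int exterior_space_Int[OF X] by blast
  next
    fix V W
    assume "V \<in> {W0 X E |E. E \<in> externology X}" "completion_open X W" "V \<subseteq> W"
    then show "W \<in> {W0 X E |E. E \<in> externology X}"
      using up by blast
  qed
qed

text \<open>A basic neighbourhood of an end given at the level \<open>E\<close> can be rewritten at any smaller level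
  \<open>D\<close>: it keeps the same ends, and its points are those of the old one that lie in \<open>D\<close>. The witness
  is the pullback of \<open>G\<close> along \<open>\<pi>\<^sub>0(D) \<rightarrow> \<pi>\<^sub>0(E)\<close>.\<close>

lemma pi0_pullback:
  assumes X: "exterior_space X" and D: "D \<in> externology X" and E: "E \<in> externology X"
    and DE: "D \<subseteq> E" and G: "openin (pi0 (subtopology (etop X) E)) G"
  obtains H where "openin (pi0 (subtopology (etop X) D)) H"
    "\<And>x. x \<in> D \<Longrightarrow> q0 (subtopology (etop X) D) x \<in> H \<longleftrightarrow> q0 (subtopology (etop X) E) x \<in> G"
    "\<And>a. a \<in> topspace (end_space X) \<Longrightarrow> eta0 D a \<in> H \<longleftrightarrow> eta0 E a \<in> G"
proof -
  let ?D = "subtopology (etop X) D" and ?E = "subtopology (etop X) E"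
  let ?H = "{C \<in> path_components_of ?D. pi0_incl ?E C \<in> G}"
  note sub = exterior_open_subset_topspace[OF X D]
  have pt: "q0 ?D x \<in> ?H \<longleftrightarrow> q0 ?E x \<in> G" if "x \<in> D" for x
  proof -
    have "x \<in> topspace ?D"
      using that sub by auto
    then show ?thesis
      using pi0_incl_q0[OF DE] by (auto simp: path_components_of_def)
  qed
  have "continuous_map ?D ?E id"
    using DE by (auto simp: continuous_map_in_subtopology continuous_map_from_subtopology)
  moreover have "openin ?E {y \<in> topspace ?E. q0 ?E y \<in> G}"
    using G by (simp only: openin_pi0)
  ultimately have "openin ?D {x \<in> topspace ?D. id x \<in> {y \<in> topspace ?E. q0 ?E y \<in> G}}"
    by (rule openin_continuous_map_preimage)
  moreover have "{x \<in> topspace ?D. id x \<in> {y \<in> topspace ?E. q0 ?E y \<in> G}}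
      = {x \<in> topspace ?D. q0 ?D x \<in> ?H}"
  proof (intro Collect_cong conj_cong refl)
    fix x
    assume "x \<in> topspace ?D"
    then show "id x \<in> {y \<in> topspace ?E. q0 ?E y \<in> G} \<longleftrightarrow> q0 ?D x \<in> ?H"
      using pt[of x] DE by auto
  qed
  ultimately have "openin (pi0 ?D) ?H"
    unfolding openin_pi0 by auto
  moreover have "eta0 D a \<in> ?H \<longleftrightarrow> eta0 E a \<in> G" if "a \<in> topspace (end_space X)" for a
    using eta0_in_pi0[OF that D] pi0_incl_eta0[OF that D E DE] by simp
  ultimately show ?thesis
    using that pt by blast
qed


section \<open>Continuity of the induced action\<close>

lemma completion_set_cases:
  assumes "z \<in> completion_set X"
  obtains (point) x where "x \<in> topspace (etop X)" "z = p0 X x"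
    | (at_end) a where "a \<in> topspace (end_space X)" "z = in0 X a"
  using assms unfolding completion_set_eq by blast

lemma p0_in_completion_set: "x \<in> topspace (etop X) \<Longrightarrow> p0 X x \<in> completion_set X"
  and in0_in_completion_set: "a \<in> topspace (end_space X) \<Longrightarrow> in0 X a \<in> completion_set X"
  by (auto simp: completion_set_eq)

text \<open>The interval is non-empty so that an end, being fixed, belongs to this set exactly if it belongs
  to \<open>W\<close>. Near such an end only points of \<open>D\<close> are used: during \<open>[c,d]\<close> they move inside one
  path-component of \<open>E\<close>, and membership of that component in \<open>G\<close> already forces them into \<open>W\<close>.\<close>

lemma completion_open_staying_set:
  assumes X: "r_exterior_flow X \<phi>" and W: "completion_open X W" and cd: "c \<le> d"
  shows "completion_open X {z \<in> completion_set X. \<forall>s\<in>{c..d}. completion_flow X \<phi> (s, z) \<in> W}"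
    (is "completion_open X ?S")
proof -
  note ext = r_exterior_flow_exterior_space[OF X] and fl = r_exterior_flow_flow[OF X]
  have p: "p0_preimage X ?S = {x \<in> topspace (etop X). \<forall>s\<in>{c..d}. \<phi> (s, x) \<in> p0_preimage X W}"
    by (auto simp: p0_preimage_def completion_flow_p0[OF X] p0_in_completion_set
        flow_in_topspace[OF fl])
  have i: "in0_preimage X ?S = in0_preimage X W"
    using cd by (auto simp: in0_preimage_def completion_flow_in0[OF X] in0_in_completion_set)
  show ?thesis
    unfolding completion_open_def p i
  proof (intro conjI ballI)
    show "?S \<subseteq> completion_set X"
      by blast
    show "openin (etop X) {x \<in> topspace (etop X). \<forall>s\<in>{c..d}. \<phi> (s, x) \<in> p0_preimage X W}"
      using fl W by (intro openin_forall_compact) (auto simp: flow_def completion_open_def)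
    show "openin (end_space X) (in0_preimage X W)"
      using W by (simp add: completion_open_def)
    fix a
    assume a: "a \<in> in0_preimage X W"
    obtain E G where E: "E \<in> externology X" and G: "openin (pi0 (subtopology (etop X) E)) G"
      "eta0 E a \<in> G" "{b \<in> topspace (end_space X). eta0 E b \<in> G} \<subseteq> in0_preimage X W"
      and GW: "{x \<in> topspace (subtopology (etop X) E). q0 (subtopology (etop X) E) x \<in> G}
        \<subseteq> p0_preimage X W"
      using W a unfolding completion_open_def by blast
    obtain D where D: "D \<in> externology X" and DE: "D \<subseteq> E"
      and stay: "\<And>x s. x \<in> D \<Longrightarrow> \<bar>s\<bar> \<le> max \<bar>c\<bar> \<bar>d\<bar> \<Longrightarrow> \<phi> (s, x) \<in> E"
      using exterior_open_confined[OF X E, of "max \<bar>c\<bar> \<bar>d\<bar>"] by blast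
    obtain H where H: "openin (pi0 (subtopology (etop X) D)) H"
      and Hpt: "\<And>x. x \<in> D \<Longrightarrow>
        q0 (subtopology (etop X) D) x \<in> H \<longleftrightarrow> q0 (subtopology (etop X) E) x \<in> G"
      and Hend: "\<And>b. b \<in> topspace (end_space X) \<Longrightarrow> eta0 D b \<in> H \<longleftrightarrow> eta0 E b \<in> G"
      using pi0_pullback[OF ext D E DE G(1)] by blast
    have "\<phi> (s, x) \<in> p0_preimage X W"
      if x: "x \<in> topspace (etop X)" "x \<in> D" "q0 (subtopology (etop X) D) x \<in> H"
        and s: "s \<in> {c..d}" for x s
    proof -
      have s': "\<bar>s\<bar> \<le> max \<bar>c\<bar> \<bar>d\<bar>"
        using s by auto
      have "q0 (subtopology (etop X) E) (\<phi> (s, x)) = q0 (subtopology (etop X) E) x"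
        using stay[OF x(2)] s' by (intro q0_flow_eq[OF fl x(1)]) auto
      then have "q0 (subtopology (etop X) E) (\<phi> (s, x)) \<in> G"
        using Hpt x by simp
      then show ?thesis
        using GW stay[OF x(2) s'] flow_in_topspace[OF fl x(1)] by auto
    qed
    then have "{x \<in> topspace (subtopology (etop X) D). q0 (subtopology (etop X) D) x \<in> H}
        \<subseteq> {x \<in> topspace (etop X). \<forall>s\<in>{c..d}. \<phi> (s, x) \<in> p0_preimage X W}"
      by auto
    moreover have "eta0 D a \<in> H"
      using a Hend G(2) by (simp add: in0_preimage_def)
    moreover have "{b \<in> topspace (end_space X). eta0 D b \<in> H} \<subseteq> in0_preimage X W"
      using G(3) Hend by blast
    ultimately show "\<exists>E\<in>externology X. \<exists>G. openin (pi0 (subtopology (etop X) E)) G \<and>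
        eta0 E a \<in> G \<and> {b \<in> topspace (end_space X). eta0 E b \<in> G} \<subseteq> in0_preimage X W \<and>
        {x \<in> topspace (subtopology (etop X) E). q0 (subtopology (etop X) E) x \<in> G}
          \<subseteq> {x \<in> topspace (etop X). \<forall>s\<in>{c..d}. \<phi> (s, x) \<in> p0_preimage X W}"
      using D H by blast
  qed
qed

lemma completion_flow_in_completion_set:
  assumes X: "r_exterior_flow X \<phi>" and z: "z \<in> completion_set X"
  shows "completion_flow X \<phi> (t, z) \<in> completion_set X"
  using z
proof (cases rule: completion_set_cases)
  case (point x)
  then show ?thesis
    by (simp add: completion_flow_p0[OF X] p0_in_completion_set
        flow_in_topspace[OF r_exterior_flow_flow[OF X]])
next
  case (at_end a)
  then show ?thesis
    by (simp add: completion_flow_in0[OF X] in0_in_completion_set)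
qed

lemma completion_orbit_open:
  assumes X: "r_exterior_flow X \<phi>" and W: "completion_open X W" and z: "z \<in> completion_set X"
  shows "open {t. completion_flow X \<phi> (t, z) \<in> W}"
  using z
proof (cases rule: completion_set_cases)
  case (point x)
  note fl = r_exterior_flow_flow[OF X]
  have "openin euclideanreal {t \<in> topspace euclideanreal. \<phi> (t, x) \<in> p0_preimage X W}"
    using W flow_orbit_continuous[OF fl point(1)]
    by (intro openin_continuous_map_preimage) (auto simp: completion_open_def)
  then show ?thesis
    using point flow_in_topspace[OF fl point(1)]
    by (simp add: completion_flow_p0[OF X] p0_preimage_def)
next
  case (at_end a)
  then show ?thesis
    by (simp add: completion_flow_in0[OF X])
qed

lemma completion_flow_continuous:
  assumes X: "r_exterior_flow X \<phi>"
  shows "continuous_map (prod_topology euclideanreal (etop (C0_completion X)))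
    (etop (C0_completion X)) (completion_flow X \<phi>)"
    (is "continuous_map ?P ?C ?f")
proof -
  note ext = r_exterior_flow_exterior_space[OF X]
  note top = topspace_completion[OF ext]
  have "openin ?P {p \<in> topspace ?P. ?f p \<in> W}" if "openin ?C W" for W
    unfolding openin_prod_topology_alt
  proof (intro allI impI)
    fix t z
    assume tz: "(t, z) \<in> {p \<in> topspace ?P. ?f p \<in> W}"
    have W: "completion_open X W"
      using that by (simp add: openin_completion[OF ext])
    have z: "z \<in> completion_set X"
      using tz top by simp
    obtain e where e: "e > 0" "cball t e \<subseteq> {s. ?f (s, z) \<in> W}"
      using completion_orbit_open[OF X W z] tz unfolding open_contains_cball by blast
    \<comment> \<open>openness of \<open>?S\<close> needs the closed interval, the box in the product the open one\<close>
    let ?S = "{z \<in> completion_set X. \<forall>s\<in>{t - e..t + e}. ?f (s, z) \<in> W}"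
    have "openin ?C ?S"
      using completion_open_staying_set[OF X W, of "t - e" "t + e"] e(1)
      by (simp add: openin_completion[OF ext])
    moreover have "z \<in> ?S"
      using z e(2) by (auto simp: cball_eq_atLeastAtMost)
    moreover have "{t - e<..<t + e} \<times> ?S \<subseteq> {p \<in> topspace ?P. ?f p \<in> W}"
      using top by auto
    moreover have "openin euclideanreal {t - e<..<t + e}" "t \<in> {t - e<..<t + e}"
      using e(1) by auto
    ultimately show "\<exists>U V. openin euclideanreal U \<and> openin ?C V \<and> t \<in> U \<and> z \<in> V \<and>
        U \<times> V \<subseteq> {p \<in> topspace ?P. ?f p \<in> W}"
      by blast
  qed
  then show ?thesis
    using completion_flow_in_completion_set[OF X] top by (auto simp: continuous_map_def)
qed

lemma completion_flow_flow:
  assumes X: "r_exterior_flow X \<phi>"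
  shows "flow (etop (C0_completion X)) (completion_flow X \<phi>)"
  unfolding flow_def topspace_completion[OF r_exterior_flow_exterior_space[OF X]]
proof (intro conjI ballI allI completion_flow_continuous[OF X])
  note fl = r_exterior_flow_flow[OF X]
  fix z and s t :: real
  assume z: "z \<in> completion_set X"
  then show "completion_flow X \<phi> (0, z) = z"
    by (cases rule: completion_set_cases)
      (use fl in \<open>auto simp: completion_flow_p0[OF X] completion_flow_in0[OF X] flow_def\<close>)
  show "completion_flow X \<phi> (s, completion_flow X \<phi> (t, z)) = completion_flow X \<phi> (s + t, z)"
    using z
  proof (cases rule: completion_set_cases)
    case (point x)
    have "\<phi> (s, \<phi> (t, x)) = \<phi> (s + t, x)"
      using fl point(1) by (simp add: flow_def)
    then show ?thesis
      using point(1) flow_in_topspace[OF fl point(1)]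
      by (simp add: point(2) completion_flow_p0[OF X])
  next
    case (at_end a)
    then show ?thesis
      by (simp add: completion_flow_in0[OF X])
  qed
qed


section \<open>Exteriority of the induced action\<close>

text \<open>The space factor is discrete, so each point may choose its own set of times: for an end every
  time will do, and for a point of \<open>X\<close> the set comes from the same condition on \<open>\<phi>\<close>.\<close>

lemma completion_flow_exterior:
  assumes X: "r_exterior_flow X \<phi>"
  shows "exterior_map
    (bar_prod real_r (discrete_topology (topspace (etop (C0_completion X)))))
    (C0_completion X) (completion_flow X \<phi>)"
    (is "exterior_map (bar_prod _ ?D) ?C ?f")
proof -
  note ext = r_exterior_flow_exterior_space[OF X]
  note top = topspace_completion[OF ext]
  have "continuous_map (prod_topology euclideanreal ?D) (prod_topology euclideanreal (etop ?C))
      (\<lambda>p. (fst p, snd p))"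
  proof (rule continuous_map_pairedI[OF continuous_map_fst])
    have "continuous_map ?D (etop ?C) id"
      by simp
    with continuous_map_snd have "continuous_map (prod_topology euclideanreal ?D) (etop ?C) (id \<circ> snd)"
      by (rule continuous_map_compose)
    then show "continuous_map (prod_topology euclideanreal ?D) (etop ?C) snd"
      by simp
  qed
  then have "continuous_map (prod_topology euclideanreal ?D) (etop ?C) (?f \<circ> (\<lambda>p. (fst p, snd p)))"
    using completion_flow_continuous[OF X] by (rule continuous_map_compose)
  then have cont: "continuous_map (prod_topology euclideanreal ?D) (etop ?C) ?f"
    by (simp add: o_def)
  have r: "etop real_r = euclideanreal"
    by (simp add: real_r_def)
  have "{p \<in> topspace (prod_topology euclideanreal ?D). ?f p \<in> W0 X E}
      \<in> externology (bar_prod real_r ?D)" (is "?A \<in> _")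
    if E: "E \<in> externology X" for E
    unfolding bar_prod_def exterior.sel mem_Collect_eq r
  proof (intro conjI ballI)
    show "openin (prod_topology euclideanreal ?D) ?A"
      using cont completion_open_W0[OF ext E]
      by (intro openin_continuous_map_preimage) (auto simp: openin_completion[OF ext])
    fix z
    assume "z \<in> topspace ?D"
    then have z: "z \<in> completion_set X"
      by (simp add: top)
    have "\<exists>T. T \<in> externology real_r \<and> T \<times> {z} \<subseteq> ?A"
      using z
    proof (cases rule: completion_set_cases)
      case (point x)
      let ?Dx = "discrete_topology (topspace (etop X))"
      have "exterior_map (bar_prod real_r ?Dx) X \<phi>"
        using X by (simp add: r_exterior_flow_def)
      then have "{p \<in> topspace (etop (bar_prod real_r ?Dx)). \<phi> p \<in> E}
          \<in> externology (bar_prod real_r ?Dx)"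
        using E by (simp add: exterior_map_def)
      then obtain U T where U: "x \<in> U" and T: "T \<in> externology real_r"
        and TU: "T \<times> U \<subseteq> {p \<in> topspace (etop (bar_prod real_r ?Dx)). \<phi> p \<in> E}"
        using externology_bar_prodD[of _ real_r ?Dx x] point(1)
        unfolding topspace_discrete_topology by blast
      have "T \<times> {z} \<subseteq> ?A"
        using U TU z point top by (auto simp: completion_flow_p0[OF X] p0_in_W0_iff[OF E ext])
      then show ?thesis
        using T by blast
    next
      case (at_end a)
      have "UNIV \<in> externology real_r"
        by (simp add: real_r_def)
      moreover have "UNIV \<times> {z} \<subseteq> ?A"
        using z at_end top by (auto simp: completion_flow_in0[OF X] in0_in_W0)
      ultimately show ?thesis
        by blast
    qed
    then show "\<exists>U T. openin ?D U \<and> z \<in> U \<and> T \<in> externology real_r \<and> T \<times> U \<subseteq> ?A"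
      using z top by (intro exI[of _ "{z}"]) auto
  qed
  then have "\<forall>E\<in>externology ?C. {p \<in> topspace (prod_topology euclideanreal ?D). ?f p \<in> E}
      \<in> externology (bar_prod real_r ?D)"
    by (auto simp: C0_completion_def)
  moreover have "etop (bar_prod real_r ?D) = prod_topology euclideanreal ?D"
    by (simp add: bar_prod_def real_r_def)
  ultimately show ?thesis
    using cont by (simp add: exterior_map_def)
qed

text \<open>One exterior open \<open>D\<close> keeps its points in \<open>E\<close> for all \<open>s \<in> [0,1]\<close> at once, so the whole of
  \<open>W\<^sub>0(D) \<times> [0,1]\<close> is sent into \<open>W\<^sub>0(E)\<close>.\<close>

lemma completion_flow_homotopy_exterior:
  assumes X: "r_exterior_flow X \<phi>"
  shows "exterior_map (bar_prod (C0_completion X) (top_of_set {0..1})) (C0_completion X)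
    (\<lambda>(z, s). completion_flow X \<phi> (t * s, z))"
    (is "exterior_map (bar_prod ?C ?I) _ ?F")
proof -
  note ext = r_exterior_flow_exterior_space[OF X]
  note top = topspace_completion[OF ext]
  have "continuous_map (prod_topology (etop ?C) ?I) euclideanreal (\<lambda>p. t * snd p)"
    using continuous_map_into_fulltopology[OF continuous_map_snd]
    by (intro continuous_map_real_mult_left)
  then have "continuous_map (prod_topology (etop ?C) ?I) (etop ?C)
      (completion_flow X \<phi> \<circ> (\<lambda>p. (t * snd p, fst p)))"
    by (intro continuous_map_compose[OF _ completion_flow_continuous[OF X]]
        continuous_map_pairedI continuous_map_fst)
  then have cont: "continuous_map (prod_topology (etop ?C) ?I) (etop ?C) ?F"
    by (simp add: o_def case_prod_unfold)
  have "{p \<in> topspace (prod_topology (etop ?C) ?I). ?F p \<in> W0 X E} \<in> externology (bar_prod ?C ?I)"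
    (is "?A \<in> _") if E: "E \<in> externology X" for E
    unfolding bar_prod_def exterior.sel mem_Collect_eq
  proof (intro conjI ballI)
    show "openin (prod_topology (etop ?C) ?I) ?A"
      using cont completion_open_W0[OF ext E]
      by (intro openin_continuous_map_preimage) (auto simp: openin_completion[OF ext])
    obtain D where D: "D \<in> externology X"
      and DE: "\<And>x s. x \<in> D \<Longrightarrow> s \<in> {0..1} \<Longrightarrow> \<phi> (t * s, x) \<in> E"
      using exterior_open_confined_one_sided[OF X E, of t] by blast
    have sub: "W0 X D \<times> topspace ?I \<subseteq> ?A"
    proof (rule subrelI)
      fix z s
      assume "(z, s) \<in> W0 X D \<times> topspace ?I"
      then have z: "z \<in> W0 X D" and s: "s \<in> topspace ?I"
        by simp_all
      have "completion_flow X \<phi> (t * s, z) \<in> W0 X E"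
      proof -
        consider x where "x \<in> D" "z = p0 X x"
          | a where "a \<in> topspace (end_space X)" "z = in0 X a"
          using z unfolding W0_def by blast
        then show ?thesis
        proof cases
          case 1
          then have "x \<in> topspace (etop X)"
            using exterior_open_subset_topspace[OF ext D] by blast
          then show ?thesis
            using 1 s DE by (simp add: completion_flow_p0[OF X] p0_in_W0_iff[OF E ext])
        qed (simp add: completion_flow_in0[OF X] in0_in_W0)
      qed
      then show "(z, s) \<in> ?A"
        using z s W0_subset_completion_set[OF ext D] top by auto
    qed
    fix s
    assume "s \<in> topspace ?I"
    moreover have "W0 X D \<in> externology ?C"
      using D by (auto simp: C0_completion_def)
    ultimately show "\<exists>U T. openin ?I U \<and> s \<in> U \<and> T \<in> externology ?C \<and> T \<times> U \<subseteq> ?A"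
      using sub openin_topspace by blast
  qed
  then have "\<forall>E\<in>externology ?C. {p \<in> topspace (prod_topology (etop ?C) ?I). ?F p \<in> E}
      \<in> externology (bar_prod ?C ?I)"
    by (auto simp: C0_completion_def)
  moreover have "etop (bar_prod ?C ?I) = prod_topology (etop ?C) ?I"
    by (simp add: bar_prod_def)
  ultimately show ?thesis
    using cont by (simp add: exterior_map_def)
qed

theorem proposition5p1:
  fixes X :: "'a exterior" and \<phi> :: "real \<times> 'a \<Rightarrow> 'a"
  assumes "r_exterior_flow X \<phi>"
  shows "r_exterior_flow (C0_completion X) (completion_flow X \<phi>)"
  unfolding r_exterior_flow_def
  using exterior_space_completion[OF r_exterior_flow_exterior_space[OF assms]]
    completion_flow_flow[OF assms] completion_flow_exterior[OF assms]
    completion_flow_homotopy_exterior[OF assms]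
  by blast

end
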